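(* Fix a field and a degree $d\ge0$, and let $\Phi$ be a data set. The function $PH_d^\Phi\colon\Phi\to\mathrm{Tame}([0,\infty)\times\mathbf{R},\mathrm{Vect})$, $\phi\mapsto PH_d^\Phi(\phi)$, is non-expansive ($1$-Lipschitz) if the set $\Phi$ is equipped with the $\infty$-norm metric $\|\phi-\psi\|_\infty$ and the set $\mathrm{Tame}([0,\infty)\times\mathbf{R},\mathrm{Vect})$ is equipped with the interleaving metric $d_{\bowtie}$ in the direction of the vector $(0,1)$; that is, for all $\phi,\psi\in\Phi$, $$d_{\bowtie}\left(PH_d^\Phi(\phi),PH_d^\Phi(\psi)\right)\le\|\phi-\psi\|_\infty.$$
   Context: A data set is a finite set $\Phi=\{\phi_i\colon X\to\mathbf{R}\mid i=1,\dots,m\}$ of real-valued functions (measurements) on a finite set $X$. Set $\|\phi-\psi\|_\infty=\max_{x\in X}|\phi(x)-\psi(x)|$. The data set induces the pseudometric $d_\Phi(x,y)=\max_{1\le i\le m}|\phi_i(x)-\phi_i(y)|$ on $X$. For $\phi\in\Phi$, $s\in\mathbf{R}$, $r\ge0$, write $(\phi\le s):=\phi^{-1}((-\infty,s])$, and let $\mathrm{VR}_r(\phi\le s,d_\Phi)$ be the Vietoris-Rips complex whose simplices are the (nonempty) subsets of $(\phi\le s)$ of $d_\Phi$-diameter not exceeding $r$. Set $PH_d^\Phi(\phi)_{r,s}:=H_d(\mathrm{VR}_r(\phi\le s,d_\Phi))$ (homology with coefficients in the fixed field); with maps induced by inclusions for $r\le r'$, $s\le s'$, this is a functor $PH_d^\Phi(\phi)$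 from the poset $[0,\infty)\times\mathbf{R}$ to vector spaces. A functor $P$ from the poset $[0,\infty)\times\mathbf{R}$ to vector spaces is tame if its values are finite dimensional and there are finite sequences $0=r_0<r_1<\cdots<r_m=\infty$ and $s_0<s_1<\cdots<s_l=\infty$ such that $P$ restricted to each $[r_i,r_{i+1})\times(-\infty,s_0)$ and each $[r_i,r_{i+1})\times[s_j,s_{j+1})$ is constant (all transition maps within the block are isomorphisms). $\mathrm{Tame}([0,\infty)\times\mathbf{R},\mathrm{Vect})$ is the category of such functors; each $PH_d^\Phi(\phi)$ is tame since $X$ is finite. For tame $P,Q$ and $\epsilon\ge0$: $P$ and $Q$ are $\epsilon$-interleaved if, for all $(r,s)\in[0,\infty)\times\mathbf{R}$, there are linear maps $f_{r,s}\colon P_{r,s}\to Q_{r,s+\epsilon}$ and $g_{r,s}\colon Q_{r,s}\to P_{r,s+\epsilon}$ such that for all $(r,s)$ the composition $g_{r,s+\epsilon}f_{r,s}$ is the transition map $P_{r,s}\to P_{r,s+2\epsilon}$ and the composition $f_{r,s+\epsilon}g_{r,s}$ is the transition map $Q_{r,s}\to Q_{r,s+2\epsilon}$. Define $d_{\bowtie}(P,Q)=\inf\{\epsilon\in[0,\infty)\mid P\text{ and }Q\text{ are }\epsilon\text{-interleaved}\}$ (the value $\infty$ is allowed); this is what is called the interleaving metric in the direction of the vector $(0,1)$. *)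

theory Defs
  imports
    Complex_Main
    "HOL-Library.Extended_Real"
    "HOL-Library.FuncSet"
    "HOL-Library.Product_Order"
    "HOL-Combinatorics.Permutations"
    "HOL-Algebra.AbelCoset"
    "Jordan_Normal_Form.Missing_VectorSpace"
begin

section \<open>Data sets and Vietoris-Rips complexes\<close>

text \<open>Functions on \<open>X\<close> are extensional, so elements of \<open>\<Phi>\<close> are determined by their values
  on \<open>X\<close>.\<close>

definition data_set :: "'x set \<Rightarrow> ('x \<Rightarrow> real) set \<Rightarrow> bool" where
  "data_set X \<Phi> \<longleftrightarrow> finite X \<and> finite \<Phi> \<and> \<Phi> \<subseteq> X \<rightarrow>\<^sub>E UNIV"

text \<open>In the next two maxima all values are nonnegative; inserting \<open>0\<close> only fixes the
  value for \<open>X = {}\<close> and \<open>\<Phi> = {}\<close>, where \<^const>\<open>Max\<close> is unspecified.\<close>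

definition sup_dist :: "'x set \<Rightarrow> ('x \<Rightarrow> real) \<Rightarrow> ('x \<Rightarrow> real) \<Rightarrow> real" where
  "sup_dist X \<phi> \<psi> = Max (insert 0 ((\<lambda>x. \<bar>\<phi> x - \<psi> x\<bar>) ` X))"

definition data_pseudometric :: "('x \<Rightarrow> real) set \<Rightarrow> 'x \<Rightarrow> 'x \<Rightarrow> real" where
  "data_pseudometric \<Phi> x y = Max (insert 0 ((\<lambda>\<phi>. \<bar>\<phi> x - \<phi> y\<bar>) ` \<Phi>))"

definition sublevel :: "'x set \<Rightarrow> ('x \<Rightarrow> real) \<Rightarrow> real \<Rightarrow> 'x set" where
  "sublevel X \<phi> s = {x \<in> X. \<phi> x \<le> s}"

definition diam :: "('x \<Rightarrow> 'x \<Rightarrow> real) \<Rightarrow> 'x set \<Rightarrow> real" where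
  "diam \<rho> \<sigma> = Max ((\<lambda>(x, y). \<rho> x y) ` (\<sigma> \<times> \<sigma>))"

definition vietoris_rips :: "('x \<Rightarrow> 'x \<Rightarrow> real) \<Rightarrow> 'x set \<Rightarrow> real \<Rightarrow> 'x set set" where
  "vietoris_rips \<rho> S r = {\<sigma>. \<sigma> \<subseteq> S \<and> \<sigma> \<noteq> {} \<and> finite \<sigma> \<and> diam \<rho> \<sigma> \<le> r}"


section \<open>Simplicial homology with coefficients in a field\<close>

text \<open>
  Abstract simplicial complexes \<open>K\<close> are sets of finite nonempty sets of vertices.  Oriented
  simplicial \<open>n\<close>-chains are represented, as usual, by finitely supported functions on the
  ordered \<open>n\<close>-simplices (tuples of \<open>n + 1\<close> distinct vertices spanning a simplex) that change
  by the sign of the permutation when the vertices are permuted.  The oriented simplex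
  \<open>[v\<^sub>0, \<dots>, v\<^sub>n]\<close> is the function with value \<open>1\<close> at even and \<open>-1\<close> at odd rearrangements of
  \<open>(v\<^sub>0, \<dots>, v\<^sub>n)\<close>, and \<open>0\<close> elsewhere.  Chains are total functions vanishing off the ordered
  simplices of \<open>K\<close>, so the chain map induced by an inclusion of complexes is the identity on
  functions.
\<close>

definition ordered_simplices :: "'x set set \<Rightarrow> nat \<Rightarrow> 'x list set" where
  "ordered_simplices K n = {w. distinct w \<and> length w = Suc n \<and> set w \<in> K}"

definition chains :: "('k, 'm) ring_scheme \<Rightarrow> 'x set set \<Rightarrow> nat \<Rightarrow> ('x list \<Rightarrow> 'k) set" where
  "chains F K n = {c.
     (\<forall>w \<in> ordered_simplices K n. c w \<in> carrier F) \<and>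
     (\<forall>w. w \<notin> ordered_simplices K n \<longrightarrow> c w = \<zero>\<^bsub>F\<^esub>) \<and>
     finite {w. c w \<noteq> \<zero>\<^bsub>F\<^esub>} \<and>
     (\<forall>w \<in> ordered_simplices K n. \<forall>p. p permutes {..<Suc n} \<longrightarrow>
        c (permute_list p w) = (if evenperm p then c w else \<ominus>\<^bsub>F\<^esub> c w))}"

text \<open>
  The linear extension of \<open>\<partial>[v\<^sub>0, \<dots>, v\<^sub>n] = \<Sum>\<^sub>i (-1)\<^sup>i [v\<^sub>0, \<dots>, v\<^sub>i\<^sub>-\<^sub>1, v\<^sub>i\<^sub>+\<^sub>1, \<dots>, v\<^sub>n]\<close>: moving \<open>v\<^sub>i\<close>
  to the front of the tuple costs the sign \<open>(-1)\<^sup>i\<close>, so the coefficient of \<open>\<partial>c\<close> at \<open>w\<close> is the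
  sum of the coefficients of \<open>c\<close> at the tuples \<open>v # w\<close>.  The case \<open>w = []\<close> makes the boundary
  of a \<open>0\<close>-chain zero (homology is not reduced).
\<close>

definition boundary :: "('k, 'm) ring_scheme \<Rightarrow> ('x list \<Rightarrow> 'k) \<Rightarrow> 'x list \<Rightarrow> 'k" where
  "boundary F c w =
     (if w = [] then \<zero>\<^bsub>F\<^esub> else (\<Oplus>\<^bsub>F\<^esub> v \<in> {v. c (v # w) \<noteq> \<zero>\<^bsub>F\<^esub>}. c (v # w)))"

definition cycles :: "('k, 'm) ring_scheme \<Rightarrow> 'x set set \<Rightarrow> nat \<Rightarrow> ('x list \<Rightarrow> 'k) set" where
  "cycles F K n = {c \<in> chains F K n. boundary F c = (\<lambda>_. \<zero>\<^bsub>F\<^esub>)}"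

definition boundaries :: "('k, 'm) ring_scheme \<Rightarrow> 'x set set \<Rightarrow> nat \<Rightarrow> ('x list \<Rightarrow> 'k) set" where
  "boundaries F K n = boundary F ` chains F K (Suc n)"

definition cycle_space ::
    "('k, 'm) ring_scheme \<Rightarrow> 'x set set \<Rightarrow> nat \<Rightarrow> ('k, 'x list \<Rightarrow> 'k) module" where
  "cycle_space F K n = (ring.func_space F UNIV)\<lparr>carrier := cycles F K n\<rparr>"

text \<open>The fields \<^const>\<open>mult\<close> and \<^const>\<open>one\<close> of the record are not used for modules.\<close>

definition quotient_space :: "('k, 'v, 'm) module_scheme \<Rightarrow> 'v set \<Rightarrow> ('k, 'v set) module" where
  "quotient_space V B =
     \<lparr>carrier = a_rcosets\<^bsub>V\<^esub> B, mult = undefined, one = undefined, zero = B,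
      add = set_add V, smult = (\<lambda>a C. \<Union>c \<in> C. B +>\<^bsub>V\<^esub> (a \<odot>\<^bsub>V\<^esub> c))\<rparr>"

definition homology ::
    "('k, 'm) ring_scheme \<Rightarrow> 'x set set \<Rightarrow> nat \<Rightarrow> ('k, ('x list \<Rightarrow> 'k) set) module" where
  "homology F K n = quotient_space (cycle_space F K n) (boundaries F K n)"

text \<open>The map induced by an inclusion \<open>K \<subseteq> L\<close>; it sends the class modulo boundaries of \<open>K\<close> of a
  cycle to its class modulo boundaries of \<open>L\<close>, and \<open>K\<close> does not enter the formula.\<close>

definition homology_inclusion ::
    "('k, 'm) ring_scheme \<Rightarrow> 'x set set \<Rightarrow> nat \<Rightarrow> ('x list \<Rightarrow> 'k) set \<Rightarrow> ('x list \<Rightarrow> 'k) set" where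
  "homology_inclusion F L n C =
     the_elem ((\<lambda>c. boundaries F L n +>\<^bsub>cycle_space F L n\<^esub> c) ` C)"


section \<open>Functors from the poset \<open>[0, \<infinity>) \<times> \<real>\<close> to vector spaces\<close>

definition index_poset :: "(real \<times> real) set" where
  "index_poset = {0..} \<times> UNIV"

record ('k, 'v) pers_module =
  obj :: "real \<times> real \<Rightarrow> ('k, 'v) module"
  trans_map :: "real \<times> real \<Rightarrow> real \<times> real \<Rightarrow> 'v \<Rightarrow> 'v"

text \<open>The order on pairs is componentwise.\<close>

definition pers_functor :: "('k, 'm) ring_scheme \<Rightarrow> ('k, 'v) pers_module \<Rightarrow> bool" where
  "pers_functor F P \<longleftrightarrow>
     (\<forall>a \<in> index_poset. vectorspace F (obj P a)) \<and>
     (\<forall>a \<in> index_poset. \<forall>b \<in> index_poset. a \<le> b \<longrightarrow>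
        linear_map F (obj P a) (obj P b) (trans_map P a b)) \<and>
     (\<forall>a \<in> index_poset. \<forall>x \<in> carrier (obj P a). trans_map P a a x = x) \<and>
     (\<forall>a \<in> index_poset. \<forall>b \<in> index_poset. \<forall>c \<in> index_poset. a \<le> b \<longrightarrow> b \<le> c \<longrightarrow>
        (\<forall>x \<in> carrier (obj P a). trans_map P b c (trans_map P a b x) = trans_map P a c x))"

definition constant_on :: "('k, 'v) pers_module \<Rightarrow> (real \<times> real) set \<Rightarrow> bool" where
  "constant_on P B \<longleftrightarrow> (\<forall>a \<in> B. \<forall>b \<in> B. a \<le> b \<longrightarrow>
     bij_betw (trans_map P a b) (carrier (obj P a)) (carrier (obj P b)))"

definition Tame :: "('k, 'm) ring_scheme \<Rightarrow> ('k, 'v) pers_module set" where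
  "Tame F = {P. pers_functor F P \<and>
     (\<forall>a \<in> index_poset. vectorspace.fin_dim F (obj P a)) \<and>
     (\<exists>(m::nat) (l::nat) (r::nat \<Rightarrow> ereal) (s::nat \<Rightarrow> ereal).
        r 0 = 0 \<and> r m = \<infinity> \<and> (\<forall>i<m. r i < r (Suc i)) \<and>
        - \<infinity> < s 0 \<and> s l = \<infinity> \<and> (\<forall>j<l. s j < s (Suc j)) \<and>
        (\<forall>i<m. constant_on P
           {(x, y). r i \<le> ereal x \<and> ereal x < r (Suc i) \<and> ereal y < s 0}) \<and>
        (\<forall>i<m. \<forall>j<l. constant_on P
           {(x, y). r i \<le> ereal x \<and> ereal x < r (Suc i) \<and>
                    s j \<le> ereal y \<and> ereal y < s (Suc j)}))}"


section \<open>The interleaving metric in the direction \<open>(0, 1)\<close>\<close>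

definition shift :: "real \<Rightarrow> real \<times> real \<Rightarrow> real \<times> real" where
  "shift \<epsilon> a = (fst a, snd a + \<epsilon>)"

text \<open>The families \<open>f\<close> and \<open>g\<close> are not required to be natural in the index.\<close>

definition interleaved ::
    "('k, 'm) ring_scheme \<Rightarrow> real \<Rightarrow> ('k, 'v) pers_module \<Rightarrow> ('k, 'w) pers_module \<Rightarrow> bool" where
  "interleaved F \<epsilon> P Q \<longleftrightarrow>
     (\<exists>f g.
        (\<forall>a \<in> index_poset. linear_map F (obj P a) (obj Q (shift \<epsilon> a)) (f a)) \<and>
        (\<forall>a \<in> index_poset. linear_map F (obj Q a) (obj P (shift \<epsilon> a)) (g a)) \<and>
        (\<forall>a \<in> index_poset. \<forall>x \<in> carrier (obj P a).
           g (shift \<epsilon> a) (f a x) = trans_map P a (shift (2 * \<epsilon>) a) x) \<and>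
        (\<forall>a \<in> index_poset. \<forall>y \<in> carrier (obj Q a).
           f (shift \<epsilon> a) (g a y) = trans_map Q a (shift (2 * \<epsilon>) a) y))"

definition interleaving_dist ::
    "('k, 'm) ring_scheme \<Rightarrow> ('k, 'v) pers_module \<Rightarrow> ('k, 'w) pers_module \<Rightarrow> ereal" where
  "interleaving_dist F P Q = Inf {ereal \<epsilon> | \<epsilon>. 0 \<le> \<epsilon> \<and> interleaved F \<epsilon> P Q}"


section \<open>Persistent homology of a measurement\<close>

definition filtration ::
    "'x set \<Rightarrow> ('x \<Rightarrow> real) set \<Rightarrow> ('x \<Rightarrow> real) \<Rightarrow> real \<times> real \<Rightarrow> 'x set set" where
  "filtration X \<Phi> \<phi> = (\<lambda>(r, s). vietoris_rips (data_pseudometric \<Phi>) (sublevel X \<phi> s) r)"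

definition PH ::
    "('k, 'm) ring_scheme \<Rightarrow> 'x set \<Rightarrow> ('x \<Rightarrow> real) set \<Rightarrow> nat \<Rightarrow> ('x \<Rightarrow> real) \<Rightarrow>
       ('k, ('x list \<Rightarrow> 'k) set) pers_module" where
  "PH F X \<Phi> d \<phi> =
     \<lparr>obj = (\<lambda>a. homology F (filtration X \<Phi> \<phi> a) d),
      trans_map = (\<lambda>a b. homology_inclusion F (filtration X \<Phi> \<phi> b) d)\<rparr>"

end

theory Submission
  imports Defs
begin

text \<open>
  If \<open>\<bar>\<phi> - \<psi>\<bar> \<le> \<epsilon>\<close> on \<open>X\<close>, then \<open>(\<phi> \<le> s)\<close> is contained in \<open>(\<psi> \<le> s + \<epsilon>)\<close> and vice versa.  Both
  filtrations use the same pseudometric \<open>d\<^sub>\<Phi>\<close>, so the Vietoris-Rips complexes at equal radius are nested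
  in the same way, and functoriality of homology for inclusions makes the induced maps an
  \<open>\<epsilon>\<close>-interleaving for \<open>\<epsilon> = \<parallel>\<phi> - \<psi>\<parallel>\<^sub>\<infinity>\<close>.  Tameness holds because the complex at \<open>(r, s)\<close> changes only when
  \<open>r\<close> passes one of the finitely many values of \<open>d\<^sub>\<Phi>\<close> or \<open>s\<close> one of those of \<open>\<phi>\<close>.
\<close>

section \<open>Chains and boundaries\<close>

text \<open>The diagonal hypothesis is separate because in characteristic 2 antisymmetry does not imply it.\<close>
lemma (in abelian_group) finsum_alternating:
  assumes "finite S" "g \<in> S \<rightarrow> S \<rightarrow> carrier G"
    and "\<And>u. u \<in> S \<Longrightarrow> g u u = \<zero>"
    and "\<And>u v. u \<in> S \<Longrightarrow> v \<in> S \<Longrightarrow> u \<noteq> v \<Longrightarrow> g u v \<oplus> g v u = \<zero>"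
  shows "(\<Oplus>u\<in>S. \<Oplus>v\<in>S. g u v) = \<zero>"
  using assms
proof (induction S rule: finite_induct)
  case empty
  show ?case by simp
next
  case (insert a S)
  have g: "g u v \<in> carrier G" if "u \<in> insert a S" "v \<in> insert a S" for u v
    using insert.prems(1) that by auto
  \<comment> \<open>The square over \<open>insert a S\<close> splits into the corner at
    \<open>a\<close>, the row and the column of \<open>a\<close>, and the square over
    \<open>S\<close>. The corner vanishes by the diagonal hypothesis, row and column cancel term by
    term, and the induction hypothesis disposes of the rest.\<close>
  have "(\<Oplus>u\<in>insert a S. \<Oplus>v\<in>insert a S. g u v) =
      (\<Oplus>v\<in>insert a S. g a v) \<oplus> (\<Oplus>u\<in>S. \<Oplus>v\<in>insert a S. g u v)"
    using insert.hyps g by (intro finsum_insert) (auto intro!: finsum_closed)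
  also have "(\<Oplus>v\<in>insert a S. g a v) = (\<Oplus>v\<in>S. g a v)"
    using insert.hyps insert.prems(2) g by (subst finsum_insert) (auto intro!: finsum_closed)
  also have "(\<Oplus>u\<in>S. \<Oplus>v\<in>insert a S. g u v) = (\<Oplus>u\<in>S. g u a \<oplus> (\<Oplus>v\<in>S. g u v))"
  proof (intro finsum_cong')
    show "(\<Oplus>v\<in>insert a S. g u v) = g u a \<oplus> (\<Oplus>v\<in>S. g u v)" if "u \<in> S" for u
      using insert.hyps g that by (intro finsum_insert) auto
  qed (use g in \<open>auto intro!: finsum_closed\<close>)
  also have "\<dots> = (\<Oplus>u\<in>S. g u a) \<oplus> (\<Oplus>u\<in>S. \<Oplus>v\<in>S. g u v)"
    using insert.hyps g by (intro finsum_addf) (auto intro!: finsum_closed)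
  also have "(\<Oplus>u\<in>S. \<Oplus>v\<in>S. g u v) = \<zero>"
  proof (rule insert.IH)
    show "g \<in> S \<rightarrow> S \<rightarrow> carrier G"
      using g by simp
    show "g u u = \<zero>" if "u \<in> S" for u
      using that by (intro insert.prems(2)) simp
    show "g u v \<oplus> g v u = \<zero>" if "u \<in> S" "v \<in> S" "u \<noteq> v" for u v
      using that by (intro insert.prems(3)) simp_all
  qed
  also have "(\<Oplus>v\<in>S. g a v) \<oplus> ((\<Oplus>u\<in>S. g u a) \<oplus> \<zero>) = (\<Oplus>v\<in>S. g a v \<oplus> g v a)"
    using insert.hyps g by (subst finsum_addf) (auto intro!: finsum_closed)
  also have "\<dots> = (\<Oplus>v\<in>S. \<zero>)"
  proof (intro finsum_cong')
    fix v assume v: "v \<in> S"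
    then show "g a v \<oplus> g v a = \<zero>"
      using insert.hyps(2) by (intro insert.prems(3)) auto
  qed auto
  finally show ?case by simp
qed

text \<open>\<open>chains\<close> and \<open>homology\<close> accept arbitrary families of vertex
  sets. Closure under nonempty faces is the property that keeps the boundary of a chain of
  \<open>K\<close> inside \<open>K\<close>.\<close>

definition face_closed :: "'x set set \<Rightarrow> bool" where
  "face_closed K \<longleftrightarrow> (\<forall>\<sigma> \<in> K. \<forall>\<tau>. \<tau> \<subseteq> \<sigma> \<longrightarrow> \<tau> \<noteq> {} \<longrightarrow> \<tau> \<in> K)"

text \<open>The tail of a tuple of degree \<open>Suc n\<close> still has \<open>Suc n\<close>
  entries, so it spans a nonempty face; the empty tail of a single vertex never arises.\<close>

lemma ordered_simplices_ConsD:
  assumes "face_closed K" "v # w \<in> ordered_simplices K (Suc n)"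
  shows "w \<in> ordered_simplices K n"
proof -
  have "set w \<subseteq> set (v # w)" "set w \<noteq> {}"
    using assms(2) by (auto simp: ordered_simplices_def)
  with assms show ?thesis
    unfolding face_closed_def ordered_simplices_def by (simp del: set_simps) blast
qed

context ring begin

text \<open>Restriction to \<open>UNIV\<close> is the identity, so the chains of all complexes lie
  in one ambient space with pointwise operations.\<close>

lemma func_space_UNIV:
  "carrier (func_space UNIV) = (UNIV \<rightarrow> carrier R)"
  "add (func_space UNIV) = (\<lambda>f g x. f x \<oplus> g x)"
  "zero (func_space UNIV) = (\<lambda>_. \<zero>)"
  "smult (func_space UNIV) = (\<lambda>a f x. a \<otimes> f x)"
  by (simp_all add: func_space_def PiE_UNIV_domain restrict_UNIV)

lemma chainD:
  assumes "c \<in> chains R K n"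
  shows chain_closed: "c w \<in> carrier R"
    and chain_outside: "w \<notin> ordered_simplices K n \<Longrightarrow> c w = \<zero>"
    and finite_chain_support: "finite {w. c w \<noteq> \<zero>}"
    and chain_permute: "w \<in> ordered_simplices K n \<Longrightarrow> p permutes {..<Suc n} \<Longrightarrow>
      c (permute_list p w) = (if evenperm p then c w else \<ominus> c w)"
proof -
  note * = assms[unfolded chains_def mem_Collect_eq]
  show "w \<notin> ordered_simplices K n \<Longrightarrow> c w = \<zero>"
    using *[THEN conjunct2, THEN conjunct1] by blast
  then show "c w \<in> carrier R"
    using *[THEN conjunct1] by (cases "w \<in> ordered_simplices K n") auto
  show "finite {w. c w \<noteq> \<zero>}"
    using * by blast
  show "w \<in> ordered_simplices K n \<Longrightarrow> p permutes {..<Suc n} \<Longrightarrow>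
      c (permute_list p w) = (if evenperm p then c w else \<ominus> c w)"
    using *[THEN conjunct2, THEN conjunct2, THEN conjunct2] by blast
qed

lemma permute_ordered_simplex_iff:
  assumes "p permutes {..<length w}"
  shows "permute_list p w \<in> ordered_simplices K n \<longleftrightarrow> w \<in> ordered_simplices K n"
  using assms by (auto simp: ordered_simplices_def)

text \<open>Exchanging the first two entries is an odd permutation, and off the ordered simplices
  both sides are zero. This sign drives the cancellation in
  \<open>boundary_boundary\<close>.\<close>

lemma chain_swap:
  assumes c: "c \<in> chains R K n"
  shows "c (u # v # w) = \<ominus> c (v # u # w)"
proof -
  define p :: "nat \<Rightarrow> nat" where "p = Transposition.transpose 0 1"
  have eq: "permute_list p (v # u # w) = u # v # w"
    by (rule nth_equalityI)
      (auto simp: permute_list_def p_def Transposition.transpose_def nth_Cons' simp del: upt_Suc)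
  have p: "p permutes {..<length (v # u # w)}"
    unfolding p_def by (intro permutes_swap_id) auto
  show ?thesis
  proof (cases "v # u # w \<in> ordered_simplices K n")
    case True
    then have "p permutes {..<Suc n}"
      using p by (simp add: ordered_simplices_def)
    from chain_permute[OF c True this] show ?thesis
      by (simp add: eq) (simp add: p_def evenperm_swap)
  next
    case False
    moreover from this have "u # v # w \<notin> ordered_simplices K n"
      using permute_ordered_simplex_iff[OF p, of K n] by (simp add: eq)
    ultimately show ?thesis
      using c by (simp add: chain_outside)
  qed
qed

text \<open>The point at issue is the sign rule at simplices of \<open>L\<close> outside
  \<open>K\<close>: there the chain is zero, and rearranging the tuple stays outside
  \<open>K\<close>.\<close>

lemma chains_mono:
  assumes "K \<subseteq> L"
  shows "chains R K n \<subseteq> chains R L n"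
proof
  fix c assume c: "c \<in> chains R K n"
  have sub: "ordered_simplices K n \<subseteq> ordered_simplices L n"
    using assms by (auto simp: ordered_simplices_def)
  have "c (permute_list p w) = (if evenperm p then c w else \<ominus> c w)"
    if w: "w \<in> ordered_simplices L n" and p: "p permutes {..<Suc n}" for w p
  proof (cases "w \<in> ordered_simplices K n")
    case True
    then show ?thesis using chain_permute[OF c] p by blast
  next
    case False
    moreover from w p have "p permutes {..<length w}"
      by (simp add: ordered_simplices_def)
    ultimately show ?thesis
      using chain_outside[OF c] permute_ordered_simplex_iff[of p w K n] by simp
  qed
  moreover have "c w = \<zero>" if "w \<notin> ordered_simplices L n" for w
    using chain_outside[OF c] sub that by blast
  ultimately show "c \<in> chains R L n"
    using chain_closed[OF c] finite_chain_support[OF c]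
    by (simp add: chains_def)
qed

text \<open>\<open>boundary\<close> sums over an exact support that varies with both
  \<open>c\<close> and \<open>w\<close>. Enlarging this range to any finite set \<open>S\<close>
  lets sums for different chains or tuples be compared termwise.\<close>

lemma boundary_eq_finsum:
  assumes "\<And>v. c (v # w) \<in> carrier R" "finite S" "\<And>v. c (v # w) \<noteq> \<zero> \<Longrightarrow> v \<in> S" "w \<noteq> []"
  shows "boundary R c w = (\<Oplus>v\<in>S. c (v # w))"
proof -
  have "(\<Oplus>v\<in>{v. c (v # w) \<noteq> \<zero>}. c (v # w)) = (\<Oplus>v\<in>S. c (v # w))"
    by (rule add.finprod_mono_neutral_cong_left) (use assms(1-3) in \<open>auto simp only: Pi_iff\<close>)
  then show ?thesis
    using assms(4) by (simp add: boundary_def)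
qed

lemma boundary_Nil [simp]: "boundary R c [] = \<zero>"
  by (simp add: boundary_def)

lemma boundary_closed:
  assumes "\<And>w. c w \<in> carrier R"
  shows "boundary R c w \<in> carrier R"
  using assms unfolding boundary_def by (simp add: Pi_iff)

lemma boundary_eq_zero:
  assumes "\<And>v. c (v # w) = \<zero>"
  shows "boundary R c w = \<zero>"
  using assms by (simp add: boundary_def)

text \<open>A nonzero coefficient of the boundary at \<open>w\<close> forces one of \<open>c\<close>
  at some \<open>v # w\<close>, so the tails of the support of \<open>c\<close> suffice.\<close>

lemma finite_boundary_support:
  assumes "finite {w. c w \<noteq> \<zero>}"
  shows "finite {w. boundary R c w \<noteq> \<zero>}"
proof (rule finite_subset)
  show "{w. boundary R c w \<noteq> \<zero>} \<subseteq> tl ` {w. c w \<noteq> \<zero>}"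
  proof
    fix w assume "w \<in> {w. boundary R c w \<noteq> \<zero>}"
    then obtain v where "c (v # w) \<noteq> \<zero>"
      using boundary_eq_zero[of c w] by auto
    then show "w \<in> tl ` {w. c w \<noteq> \<zero>}"
      by (intro image_eqI[of _ _ "v # w"]) auto
  qed
qed (use assms in simp)

text \<open>Transporting \<open>p\<close> along \<open>Suc\<close> moves every index up by one,
  fixes \<open>0\<close> and keeps the parity. A permutation of a face thereby becomes a permutation
  of the simplex with the same sign.\<close>

lemma permute_list_Cons:
  assumes p: "p permutes {..<length w}"
  obtains q where "q permutes {..<Suc (length w)}" "evenperm q \<longleftrightarrow> evenperm p"
    "permute_list q (v # w) = v # permute_list p w"
proof
  let ?q = "map_permutation {..<length w} Suc p"
  have "?q permutes Suc ` {..<length w}"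
    using p by (intro map_permutation_permutes) (auto simp: bij_betw_def)
  then show "?q permutes {..<Suc (length w)}"
    by (rule permutes_subset) auto
  show "evenperm ?q \<longleftrightarrow> evenperm p"
    using p by (intro evenperm_map_permutation) auto
  have q0: "?q 0 = 0"
    by (auto simp: map_permutation_def)
  have qS: "?q (Suc i) = Suc (p i)" if "i < length w" for i
    using that by (simp add: map_permutation_def restrict_id_def)
  show "permute_list ?q (v # w) = v # permute_list p w"
    by (rule nth_equalityI)
      (auto simp: permute_list_def nth_Cons' q0 qS gr0_conv_Suc simp del: upt_Suc)
qed

lemma chainI:
  assumes "\<And>w. w \<in> ordered_simplices K n \<Longrightarrow> c w \<in> carrier R"
    and "\<And>w. w \<notin> ordered_simplices K n \<Longrightarrow> c w = \<zero>"
    and "finite {w. c w \<noteq> \<zero>}"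
    and "\<And>w p. w \<in> ordered_simplices K n \<Longrightarrow> p permutes {..<Suc n} \<Longrightarrow>
      c (permute_list p w) = (if evenperm p then c w else \<ominus> c w)"
  shows "c \<in> chains R K n"
  unfolding chains_def mem_Collect_eq using assms by blast

lemma boundary_chain_eq_finsum:
  assumes c: "c \<in> chains R K n" and S: "finite S" "\<And>w. c w \<noteq> \<zero> \<Longrightarrow> hd w \<in> S" and "w \<noteq> []"
  shows "boundary R c w = (\<Oplus>v\<in>S. c (v # w))"
proof (rule boundary_eq_finsum[OF chain_closed[OF c] S(1) _ \<open>w \<noteq> []\<close>])
  show "v \<in> S" if "c (v # w) \<noteq> \<zero>" for v
    using S(2)[OF that] by simp
qed

lemma boundary_add:
  assumes c: "c \<in> chains R K n" and c': "c' \<in> chains R L m"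
  shows "boundary R (\<lambda>w. c w \<oplus> c' w) w = boundary R c w \<oplus> boundary R c' w"
proof (cases "w = []")
  case False
  \<comment> \<open>Coefficients may cancel in the sum, so its support can be smaller than those of
    \<open>c\<close> and \<open>c'\<close>; the heads of both supports give one range for all three
    boundaries.\<close>
  let ?S = "hd ` ({w. c w \<noteq> \<zero>} \<union> {w. c' w \<noteq> \<zero>})"
  have fin: "finite ?S"
    using finite_chain_support[OF c] finite_chain_support[OF c'] by simp
  have mem: "v \<in> ?S" if "c (v # w) \<noteq> \<zero> \<or> c' (v # w) \<noteq> \<zero>" for v
    using that by (intro image_eqI[of _ _ "v # w"]) simp_all
  have "boundary R (\<lambda>w. c w \<oplus> c' w) w = (\<Oplus>v\<in>?S. c (v # w) \<oplus> c' (v # w))"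
  proof (rule boundary_eq_finsum[OF _ fin _ False])
    show "v \<in> ?S" if "c (v # w) \<oplus> c' (v # w) \<noteq> \<zero>" for v
      by (rule mem) (use that in auto)
  qed (simp add: chain_closed[OF c] chain_closed[OF c'])
  also have "\<dots> = (\<Oplus>v\<in>?S. c (v # w)) \<oplus> (\<Oplus>v\<in>?S. c' (v # w))"
    by (rule finsum_addf) (simp_all add: chain_closed[OF c] chain_closed[OF c'])
  also have "(\<Oplus>v\<in>?S. c (v # w)) = boundary R c w"
    by (rule boundary_eq_finsum[symmetric, OF chain_closed[OF c] fin _ False]) (rule mem, simp)
  also have "(\<Oplus>v\<in>?S. c' (v # w)) = boundary R c' w"
    by (rule boundary_eq_finsum[symmetric, OF chain_closed[OF c'] fin _ False]) (rule mem, simp)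
  finally show ?thesis .
qed simp

lemma boundary_smult:
  assumes c: "c \<in> chains R K n" and a: "a \<in> carrier R"
  shows "boundary R (\<lambda>w. a \<otimes> c w) w = a \<otimes> boundary R c w"
proof (cases "w = []")
  case False
  let ?S = "hd ` {w. c w \<noteq> \<zero>}"
  have fin: "finite ?S"
    using finite_chain_support[OF c] by simp
  have mem: "v \<in> ?S" if "c (v # w) \<noteq> \<zero>" for v
    using that by (intro image_eqI[of _ _ "v # w"]) simp_all
  have "boundary R (\<lambda>w. a \<otimes> c w) w = (\<Oplus>v\<in>?S. a \<otimes> c (v # w))"
  proof (rule boundary_eq_finsum[OF _ fin _ False])
    show "v \<in> ?S" if "a \<otimes> c (v # w) \<noteq> \<zero>" for v
      by (rule mem) (use that a in auto)
  qed (simp add: chain_closed[OF c] a)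
  also have "\<dots> = a \<otimes> (\<Oplus>v\<in>?S. c (v # w))"
    by (rule finsum_rdistr[symmetric]) (use fin a chain_closed[OF c] in simp_all)
  also have "(\<Oplus>v\<in>?S. c (v # w)) = boundary R c w"
    by (rule boundary_eq_finsum[symmetric, OF chain_closed[OF c] fin mem False])
  finally show ?thesis .
qed (simp add: a)

text \<open>Face closure gives the vanishing off the ordered simplices. For the sign rule, a
  permutation of \<open>w\<close> extends to \<open>v # w\<close> with \<open>v\<close> fixed and
  equal parity, so every summand picks up the same sign.\<close>

lemma boundary_in_chains:
  assumes K: "face_closed K" and c: "c \<in> chains R K (Suc n)"
  shows "boundary R c \<in> chains R K n"
proof (rule chainI)
  show "boundary R c w \<in> carrier R" for w
    by (rule boundary_closed) (rule chain_closed[OF c])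
  show "finite {w. boundary R c w \<noteq> \<zero>}"
    by (rule finite_boundary_support) (rule finite_chain_support[OF c])
  show "boundary R c w = \<zero>" if "w \<notin> ordered_simplices K n" for w
    by (rule boundary_eq_zero, rule chain_outside[OF c])
      (use that ordered_simplices_ConsD[OF K] in blast)
  show "boundary R c (permute_list p w) = (if evenperm p then boundary R c w else \<ominus> boundary R c w)"
    if w: "w \<in> ordered_simplices K n" and p: "p permutes {..<Suc n}" for w p
  proof -
    \<comment> \<open>Heads of the whole support do not depend on the tuple, so this range serves
      \<open>w\<close> and its rearrangement alike.\<close>
    let ?S = "hd ` {w. c w \<noteq> \<zero>}"
    have fin: "finite ?S"
      using finite_chain_support[OF c] by simp
    have S: "hd w \<in> ?S" if "c w \<noteq> \<zero>" for w
      using that by simp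
    have len: "length w = Suc n"
      using w by (simp add: ordered_simplices_def)
    then have ne: "w \<noteq> []" "permute_list p w \<noteq> []"
      by (auto simp flip: length_greater_0_conv)
    have "c (v # permute_list p w) = (if evenperm p then c (v # w) else \<ominus> c (v # w))" for v
    proof -
      obtain q where q: "q permutes {..<Suc (length w)}" "evenperm q \<longleftrightarrow> evenperm p"
          "permute_list q (v # w) = v # permute_list p w"
        using permute_list_Cons p len by metis
      show ?thesis
      proof (cases "v # w \<in> ordered_simplices K (Suc n)")
        case True
        then show ?thesis
          using chain_permute[OF c True, of q] q len by simp
      next
        case False
        then have "v # permute_list p w \<notin> ordered_simplices K (Suc n)"
          using permute_ordered_simplex_iff[of q "v # w" K "Suc n"] q by simp
        with False show ?thesis
          by (simp add: chain_outside[OF c])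
      qed
    qed
    then have "boundary R c (permute_list p w) =
        (\<Oplus>v\<in>?S. if evenperm p then c (v # w) else \<ominus> c (v # w))"
      by (simp add: boundary_chain_eq_finsum[OF c fin S ne(2)])
    also have "\<dots> = (if evenperm p then boundary R c w else \<ominus> boundary R c w)"
    proof -
      have "(\<Oplus>v\<in>?S. \<ominus> c (v # w)) = \<ominus> (\<Oplus>v\<in>?S. c (v # w))"
        using finsum_rdistr[OF fin, of "\<ominus> \<one>" "\<lambda>v. c (v # w)"]
        by (simp add: l_minus chain_closed[OF c] Pi_iff)
      then show ?thesis
        by (simp add: boundary_chain_eq_finsum[OF c fin S ne(1)])
    qed
    finally show ?thesis .
  qed
qed

text \<open>At a nonempty \<open>w\<close> the coefficient is a double sum of the terms
  \<open>c (u # v # w)\<close>, which are antisymmetric in \<open>u\<close> and \<open>v\<close> by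
  \<open>chain_swap\<close> and zero on the diagonal.\<close>

lemma boundary_boundary:
  assumes c: "c \<in> chains R K n"
  shows "boundary R (boundary R c) w = \<zero>"
proof (cases "w = []")
  case False
  \<comment> \<open>Taking all vertices of the support, rather than only the heads, makes
    \<open>u\<close> and \<open>v\<close> range over the same set, as
    \<open>finsum_alternating\<close> requires.\<close>
  let ?S = "\<Union> (set ` {w. c w \<noteq> \<zero>})"
  have fin: "finite ?S"
    using finite_chain_support[OF c] by simp
  have mem: "u \<in> ?S" if "c x \<noteq> \<zero>" "u \<in> set x" for u x
    using that by auto
  have "boundary R (boundary R c) w = (\<Oplus>v\<in>?S. boundary R c (v # w))"
  proof (rule boundary_eq_finsum[OF _ fin _ False])
    show "boundary R c (v # w) \<in> carrier R" for v
      by (rule boundary_closed) (rule chain_closed[OF c])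
    show "v \<in> ?S" if nz: "boundary R c (v # w) \<noteq> \<zero>" for v
    proof -
      obtain u where "c (u # v # w) \<noteq> \<zero>"
        using nz boundary_eq_zero[of c "v # w"] by metis
      then show ?thesis by (rule mem) simp
    qed
  qed
  also have "\<dots> = (\<Oplus>v\<in>?S. \<Oplus>u\<in>?S. c (u # v # w))"
  proof (rule arg_cong[of _ _ "\<lambda>f. finsum R f ?S"], rule ext)
    show "boundary R c (v # w) = (\<Oplus>u\<in>?S. c (u # v # w))" for v
      by (rule boundary_eq_finsum[OF chain_closed[OF c] fin]) (erule mem, simp_all)
  qed
  also have "\<dots> = \<zero>"
  proof (rule finsum_alternating[OF fin])
    \<comment> \<open>A tuple with a repeated vertex is not an ordered simplex; this gives the
      diagonal condition in every characteristic.\<close>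
    show "c (u # u # w) = \<zero>" for u
      by (rule chain_outside[OF c]) (simp add: ordered_simplices_def)
    show "c (u # v # w) \<oplus> c (v # u # w) = \<zero>" for u v
      by (subst chain_swap[OF c]) (simp add: l_neg chain_closed[OF c])
  qed (simp add: chain_closed[OF c])
  finally show ?thesis .
qed simp

end

section \<open>Cycles and boundaries as linear subspaces\<close>

context cring begin

lemma submodule_func_spaceI:
  assumes "N \<subseteq> UNIV \<rightarrow> carrier R" "(\<lambda>_. \<zero>) \<in> N"
    and "\<And>f g. f \<in> N \<Longrightarrow> g \<in> N \<Longrightarrow> (\<lambda>x. f x \<oplus> g x) \<in> N"
    and "\<And>a f. a \<in> carrier R \<Longrightarrow> f \<in> N \<Longrightarrow> (\<lambda>x. a \<otimes> f x) \<in> N"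
  shows "submodule R N (func_space UNIV)"
  using assms func_space_is_module by (intro submodule.intro) (simp_all add: func_space_UNIV)

lemma zero_chain: "(\<lambda>_. \<zero>) \<in> chains R K n"
  by (rule chainI) simp_all

lemma add_chain:
  assumes c: "c \<in> chains R K n" and c': "c' \<in> chains R K n"
  shows "(\<lambda>w. c w \<oplus> c' w) \<in> chains R K n"
proof (rule chainI)
  show "finite {w. c w \<oplus> c' w \<noteq> \<zero>}"
    by (rule finite_subset[of _ "{w. c w \<noteq> \<zero>} \<union> {w. c' w \<noteq> \<zero>}"])
      (auto simp: finite_chain_support[OF c] finite_chain_support[OF c'])
qed (simp_all add: chain_closed[OF c] chain_closed[OF c'] chain_outside[OF c] chain_outside[OF c']
    chain_permute[OF c] chain_permute[OF c'] minus_add)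

lemma smult_chain:
  assumes c: "c \<in> chains R K n" and a: "a \<in> carrier R"
  shows "(\<lambda>w. a \<otimes> c w) \<in> chains R K n"
proof (rule chainI)
  show "finite {w. a \<otimes> c w \<noteq> \<zero>}"
    by (rule finite_subset[OF _ finite_chain_support[OF c]]) (use a in auto)
qed (simp_all add: a chain_closed[OF c] chain_outside[OF c] chain_permute[OF c] r_minus)

lemma boundary_zero: "boundary R (\<lambda>_. \<zero>) = (\<lambda>_. \<zero>)"
  by (simp add: fun_eq_iff boundary_eq_zero)

lemma cycleD:
  assumes "c \<in> cycles R K n"
  shows "c \<in> chains R K n" and "boundary R c = (\<lambda>_. \<zero>)"
  using assms by (simp_all add: cycles_def)

lemma cycles_submodule: "submodule R (cycles R K n) (func_space UNIV)"
proof (rule submodule_func_spaceI)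
  show "cycles R K n \<subseteq> UNIV \<rightarrow> carrier R"
    using chain_closed cycleD(1) by fast
  show "(\<lambda>_. \<zero>) \<in> cycles R K n"
    by (simp add: cycles_def zero_chain boundary_zero)
  show "(\<lambda>w. c w \<oplus> c' w) \<in> cycles R K n"
    if "c \<in> cycles R K n" "c' \<in> cycles R K n" for c c'
    using boundary_add[OF that[THEN cycleD(1)]] that[THEN cycleD(2)]
    by (simp add: fun_eq_iff cycles_def add_chain[OF that[THEN cycleD(1)]])
  show "(\<lambda>w. a \<otimes> c w) \<in> cycles R K n" if "a \<in> carrier R" "c \<in> cycles R K n" for a c
    using boundary_smult[OF that(2)[THEN cycleD(1)] that(1)] that(2)[THEN cycleD(2)]
    by (simp add: fun_eq_iff cycles_def smult_chain[OF that(2)[THEN cycleD(1)]] that(1))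
qed

lemma boundaries_subset_cycles:
  assumes "face_closed K"
  shows "boundaries R K n \<subseteq> cycles R K n"
  unfolding boundaries_def cycles_def
  by (auto simp: boundary_in_chains[OF assms] boundary_boundary)

lemma boundaries_submodule:
  assumes "face_closed K"
  shows "submodule R (boundaries R K n) (func_space UNIV)"
proof (rule submodule_func_spaceI)
  show "boundaries R K n \<subseteq> UNIV \<rightarrow> carrier R"
    using boundaries_subset_cycles[OF assms, of n] chain_closed cycleD(1) by fast
  show "(\<lambda>_. \<zero>) \<in> boundaries R K n"
    unfolding boundaries_def
    by (rule image_eqI[of _ _ "\<lambda>_. \<zero>"]) (simp_all add: zero_chain boundary_zero)
  show "(\<lambda>w. b w \<oplus> b' w) \<in> boundaries R K n"
    if "b \<in> boundaries R K n" and "b' \<in> boundaries R K n" for b b'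
  proof -
    obtain c c' where c: "c \<in> chains R K (Suc n)" "c' \<in> chains R K (Suc n)"
        and b: "b = boundary R c" "b' = boundary R c'"
      using \<open>b \<in> _\<close> \<open>b' \<in> _\<close> unfolding boundaries_def by blast
    show ?thesis
      unfolding boundaries_def b
      by (rule image_eqI[OF _ add_chain[OF c]]) (simp add: fun_eq_iff boundary_add[OF c])
  qed
  show "(\<lambda>w. a \<otimes> b w) \<in> boundaries R K n" if a: "a \<in> carrier R" and "b \<in> boundaries R K n" for a b
  proof -
    obtain c where c: "c \<in> chains R K (Suc n)" and b: "b = boundary R c"
      using \<open>b \<in> boundaries R K n\<close> by (auto simp: boundaries_def)
    show ?thesis
      unfolding boundaries_def b
      by (rule image_eqI[OF _ smult_chain[OF c a]]) (simp add: fun_eq_iff boundary_smult[OF c a])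
  qed
qed

lemma cycles_mono: "K \<subseteq> L \<Longrightarrow> cycles R K n \<subseteq> cycles R L n"
  using chains_mono[of K L n] by (auto simp: cycles_def)

lemma boundaries_mono: "K \<subseteq> L \<Longrightarrow> boundaries R K n \<subseteq> boundaries R L n"
  unfolding boundaries_def by (intro image_mono chains_mono)

end

section \<open>Quotients and dimension\<close>

context vectorspace begin

context
  fixes B
  assumes B: "submodule K B V"
begin

text \<open>Makes the coset theory of abelian groups available. Negatives in \<open>B\<close> come
  from scaling by \<open>\<ominus> \<one>\<close>.\<close>

lemma abelian_subgroup_submodule: "abelian_subgroup B V"
proof (rule abelian_subgroupI3)
  interpret B: submodule K B V by (rule B)
  have "\<ominus>\<^bsub>V\<^esub> x \<in> B" if "x \<in> B" for x
  proof -
    have "x \<in> carrier V"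
      using that B.subset by blast
    moreover have "(\<ominus>\<^bsub>K\<^esub> \<one>\<^bsub>K\<^esub>) \<odot>\<^bsub>V\<^esub> x \<in> B"
      using that by (intro B.smult_closed) simp_all
    ultimately show ?thesis
      by (simp only: smult_minus_1)
  qed
  then show "additive_subgroup B V"
    using B.subset
    by (intro additive_subgroupI subgroup.intro) (auto simp flip: a_inv_def)
qed (rule abelian_group_axioms)

interpretation B: abelian_subgroup B V
  by (rule abelian_subgroup_submodule)

lemma quotient_space_simps:
  "carrier (quotient_space V B) = (\<lambda>x. B +>\<^bsub>V\<^esub> x) ` carrier V"
  "zero (quotient_space V B) = B +>\<^bsub>V\<^esub> \<zero>\<^bsub>V\<^esub>"
  "x \<in> carrier V \<Longrightarrow> y \<in> carrier V \<Longrightarrow>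
    add (quotient_space V B) (B +>\<^bsub>V\<^esub> x) (B +>\<^bsub>V\<^esub> y) = B +>\<^bsub>V\<^esub> (x \<oplus>\<^bsub>V\<^esub> y)"
  by (auto simp: quotient_space_def A_RCOSETS_def' B.a_rcos_sum B.a_rcos_const)

lemma coset_eq_iff:
  assumes "x \<in> carrier V" "y \<in> carrier V"
  shows "B +>\<^bsub>V\<^esub> x = B +>\<^bsub>V\<^esub> y \<longleftrightarrow> x \<ominus>\<^bsub>V\<^esub> y \<in> B"
proof -
  have "B +>\<^bsub>V\<^esub> x = B +>\<^bsub>V\<^esub> y \<longleftrightarrow> x \<in> B +>\<^bsub>V\<^esub> y"
    using B.a_rcos_self[OF assms(1)] B.a_repr_independence'[OF _ assms(2)] by auto
  also have "\<dots> \<longleftrightarrow> x \<ominus>\<^bsub>V\<^esub> y \<in> B"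
    using B.a_rcos_module[OF assms(2,1)] by (simp add: a_minus_def)
  finally show ?thesis .
qed

text \<open>The scalar multiple is defined as a union of cosets over all representatives. These
  cosets coincide because \<open>B\<close> is closed under scaling, and there is at least one
  representative, so the union is a single coset.\<close>

lemma quotient_space_smult:
  assumes "a \<in> carrier K" "x \<in> carrier V"
  shows "smult (quotient_space V B) a (B +>\<^bsub>V\<^esub> x) = B +>\<^bsub>V\<^esub> (a \<odot>\<^bsub>V\<^esub> x)"
proof -
  interpret S: submodule K B V by (rule B)
  have "B +>\<^bsub>V\<^esub> (a \<odot>\<^bsub>V\<^esub> y) = B +>\<^bsub>V\<^esub> (a \<odot>\<^bsub>V\<^esub> x)" if "y \<in> B +>\<^bsub>V\<^esub> x" for y
  proof -
    have y: "y \<in> carrier V"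
      using B.a_elemrcos_carrier assms(2) that by blast
    have "y \<ominus>\<^bsub>V\<^esub> x \<in> B"
      using B.a_rcos_module_imp[OF assms(2) that] by (simp add: a_minus_def)
    then have "a \<odot>\<^bsub>V\<^esub> (y \<ominus>\<^bsub>V\<^esub> x) \<in> B"
      using assms(1) by simp
    then have "a \<odot>\<^bsub>V\<^esub> y \<ominus>\<^bsub>V\<^esub> a \<odot>\<^bsub>V\<^esub> x \<in> B"
      using assms y by (simp add: a_minus_def smult_r_distr smult_r_minus)
    then show ?thesis
      using assms y by (simp add: coset_eq_iff)
  qed
  then have "(\<Union>y\<in>B +>\<^bsub>V\<^esub> x. B +>\<^bsub>V\<^esub> (a \<odot>\<^bsub>V\<^esub> y)) = (\<Union>y\<in>B +>\<^bsub>V\<^esub> x. B +>\<^bsub>V\<^esub> (a \<odot>\<^bsub>V\<^esub> x))"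
    by (intro SUP_cong refl)
  moreover have "B +>\<^bsub>V\<^esub> x \<noteq> {}"
    using B.a_rcos_self[OF assms(2)] by blast
  ultimately show ?thesis
    by (simp add: quotient_space_def)
qed

lemma quotient_space_is_vs: "vectorspace K (quotient_space V B)"
proof -
  let ?Q = "quotient_space V B"
  note simps = quotient_space_simps quotient_space_smult
  show ?thesis
  proof (rule vs_criteria)
    show "field K" ..
    show "\<forall>v\<in>carrier ?Q. \<exists>w\<in>carrier ?Q. v \<oplus>\<^bsub>?Q\<^esub> w = \<zero>\<^bsub>?Q\<^esub>"
    proof
      fix v assume "v \<in> carrier ?Q"
      then obtain x where "x \<in> carrier V" "v = B +>\<^bsub>V\<^esub> x"
        by (auto simp: simps)
      then show "\<exists>w\<in>carrier ?Q. v \<oplus>\<^bsub>?Q\<^esub> w = \<zero>\<^bsub>?Q\<^esub>"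
        by (intro bexI[of _ "B +>\<^bsub>V\<^esub> (\<ominus>\<^bsub>V\<^esub> x)"]) (simp_all add: simps M.r_neg)
    qed
  qed (auto simp: simps M.add.m_ac smult_assoc1 smult_l_distr smult_r_distr)
qed

lemma coset_linear_map: "linear_map K V (quotient_space V B) (\<lambda>x. B +>\<^bsub>V\<^esub> x)"
proof -
  interpret Q: vectorspace K "quotient_space V B"
    by (rule quotient_space_is_vs)
  show ?thesis
    by unfold_locales (simp add: module_hom_def quotient_space_simps quotient_space_smult)
qed

text \<open>The projection is linear and onto, and a linear image of a finite dimensional space is
  finite dimensional.\<close>

lemma fin_dim_quotient_space:
  assumes "fin_dim"
  shows "vectorspace.fin_dim K (quotient_space V B)"
proof -
  interpret proj: linear_map K V "quotient_space V B" "\<lambda>x. B +>\<^bsub>V\<^esub> x"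
    by (rule coset_linear_map)
  show ?thesis
    by (rule proj.surj_fin_dim[OF assms quotient_space_simps(1)[symmetric]])
qed

end
end

text \<open>Boundaries are first recognised as a subspace of the ambient function space, while
  homology divides the smaller cycle space; this bridges the two.\<close>

lemma (in module) submodule_restrict:
  assumes "submodule R N M" "submodule R B M" "B \<subseteq> N"
  shows "submodule R B (M\<lparr>carrier := N\<rparr>)"
proof -
  interpret B: submodule R B M by (rule assms)
  show ?thesis
    using submodule_is_module[OF assms(1)] assms(3) by (intro submodule.intro) simp_all
qed

section \<open>Finite dimension of the cycle spaces\<close>

context field begin

lemma func_space_vectorspace: "vectorspace R (func_space S)"
  by (intro vectorspace.intro func_space_is_module field_axioms)

text \<open>Gaussian elimination at one point of the support at a time.\<close>
lemma finitely_generated_finite_support: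
  assumes "finite S" "submodule R N (func_space UNIV)" "\<And>f x. f \<in> N \<Longrightarrow> x \<notin> S \<Longrightarrow> f x = \<zero>"
  shows "\<exists>A. finite A \<and> A \<subseteq> N \<and> N \<subseteq> module.span R (func_space UNIV) A"
  using assms
proof (induction S arbitrary: N rule: finite_induct)
  case empty
  interpret V: vectorspace R "func_space UNIV" by (rule func_space_vectorspace)
  have "N \<subseteq> {\<zero>\<^bsub>func_space UNIV\<^esub>}"
    using empty.prems(2) by (auto simp: func_space_UNIV)
  then show ?case
    by (intro exI[of _ "{}"]) (simp add: V.span_empty)
next
  case (insert a S)
  interpret V: vectorspace R "func_space UNIV" by (rule func_space_vectorspace)
  interpret N: submodule R N "func_space UNIV" by (rule insert.prems(1))
  have N_closed: "f x \<in> carrier R" if "f \<in> N" for f x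
    using N.subset that by (auto simp: func_space_UNIV)
  show ?case
  proof (cases "\<forall>f\<in>N. f a = \<zero>")
    case True
    have "f x = \<zero>" if "f \<in> N" "x \<notin> S" for f x
      using insert.prems(2)[of f x] True that by (cases "x = a") auto
    then show ?thesis
      by (rule insert.IH[OF insert.prems(1)])
  next
    case False
    then obtain c where c: "c \<in> N" "c a \<noteq> \<zero>"
      by blast
    then have ca: "c a \<in> Units R"
      using N_closed by (simp add: field_Units)
    \<comment> \<open>Functions of \<open>N\<close> vanishing at \<open>a\<close> are supported in
      \<open>S\<close>, so the induction hypothesis supplies generators for them; \<open>c\<close>
      serves as the pivot for the remaining direction.\<close>
    define N' where "N' = {f \<in> N. f a = \<zero>}"
    have "submodule R N' (func_space UNIV)"
      using N.subset N.m_closed N.zero_closed N.smult_closed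
      by (intro submodule_func_spaceI) (auto simp: N'_def func_space_UNIV)
    moreover have "f x = \<zero>" if "f \<in> N'" "x \<notin> S" for f x
      using insert.prems(2)[of f x] that by (cases "x = a") (auto simp: N'_def)
    ultimately obtain A where A: "finite A" "A \<subseteq> N'" "N' \<subseteq> V.span A"
      using insert.IH[of N'] by metis
    have sub: "insert c A \<subseteq> N"
      using A(2) c(1) by (auto simp: N'_def)
    then have sub': "insert c A \<subseteq> carrier (func_space UNIV)"
      using N.subset by blast
    interpret T: submodule R "V.span (insert c A)" "func_space UNIV"
      by (rule V.span_is_submodule[OF sub'])
    have "f \<in> V.span (insert c A)" if f: "f \<in> N" for f
    proof -
      \<comment> \<open>Subtracting \<open>k\<close> times the pivot clears the value at
        \<open>a\<close>.\<close>
      define k where "k = f a \<otimes> inv (c a)"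
      have k: "k \<in> carrier R"
        using ca N_closed[OF f] by (simp add: k_def)
      define g where "g = f \<oplus>\<^bsub>func_space UNIV\<^esub> ((\<ominus> k) \<odot>\<^bsub>func_space UNIV\<^esub> c)"
      have "g \<in> N"
        unfolding g_def using f c(1) k by simp
      moreover have "g a = \<zero>"
      proof -
        have "k \<otimes> c a = f a"
          using ca N_closed[OF f] N_closed[OF c(1)] by (simp add: k_def m_assoc Units_l_inv)
        then show ?thesis
          using k N_closed[OF f] N_closed[OF c(1)]
          by (simp add: g_def func_space_UNIV l_minus r_neg)
      qed
      ultimately have "g \<in> V.span A"
        using A(3) by (auto simp: N'_def)
      then have "g \<in> V.span (insert c A)"
        using V.span_is_monotone[of A "insert c A"] by blast
      moreover have "c \<in> V.span (insert c A)"
        using V.in_own_span[OF sub'] by blast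
      ultimately have "g \<oplus>\<^bsub>func_space UNIV\<^esub> (k \<odot>\<^bsub>func_space UNIV\<^esub> c) \<in> V.span (insert c A)"
        using k by simp
      also have "g \<oplus>\<^bsub>func_space UNIV\<^esub> (k \<odot>\<^bsub>func_space UNIV\<^esub> c) = f"
        using k N_closed[OF f] N_closed[OF c(1)]
        by (simp add: g_def func_space_UNIV fun_eq_iff a_assoc l_minus l_neg)
      finally show ?thesis .
    qed
    then show ?thesis
      using A(1) sub by (intro exI[of _ "insert c A"]) auto
  qed
qed

lemma cycle_space_vectorspace: "vectorspace R (cycle_space R K n)"
proof -
  interpret V: vectorspace R "func_space UNIV" by (rule func_space_vectorspace)
  show ?thesis
    unfolding cycle_space_def
    by (intro vectorspace.intro V.submodule_is_module cycles_submodule field_axioms)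
qed

text \<open>Finitely many vertices span finitely many tuples of length \<open>Suc n\<close>, and
  every cycle vanishes off this finite set.\<close>

lemma fin_dim_cycle_space:
  assumes "finite (\<Union>K)"
  shows "vectorspace.fin_dim R (cycle_space R K n)"
proof -
  interpret V: vectorspace R "func_space UNIV" by (rule func_space_vectorspace)
  interpret Z: vectorspace R "cycle_space R K n" by (rule cycle_space_vectorspace)
  have "finite {w. set w \<subseteq> \<Union>K \<and> length w = Suc n}"
    using assms by (rule finite_lists_length_eq)
  then have "finite (ordered_simplices K n)"
    by (rule rev_finite_subset) (auto simp: ordered_simplices_def)
  then have "\<exists>A. finite A \<and> A \<subseteq> cycles R K n \<and> cycles R K n \<subseteq> V.span A"
    by (rule finitely_generated_finite_support[OF _ cycles_submodule])
      (rule chain_outside[OF cycleD(1)])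
  then obtain A where A: "finite A" "A \<subseteq> cycles R K n" "cycles R K n \<subseteq> V.span A"
    by blast
  have "V.span A = cycles R K n"
    using A(3) V.span_is_subset[OF A(2) cycles_submodule] by blast
  \<comment> \<open>The generators were found in the ambient function space; spans computed there
    and in the subspace of cycles agree.\<close>
  then have "Z.span A = carrier (cycle_space R K n)"
    using V.span_li_not_depend(1)[OF A(2) cycles_submodule] by (simp add: cycle_space_def)
  then show ?thesis
    unfolding Z.fin_dim_def using A by (intro exI[of _ A]) (simp add: cycle_space_def)
qed

end

section \<open>Maps induced by inclusions\<close>

locale simplicial_complex = field R for R (structure) +
  fixes K :: "'x set set" and n :: nat
  assumes face_closed: "face_closed K"
begin

sublocale Z: vectorspace R "cycle_space R K n"
  by (rule cycle_space_vectorspace)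

lemma boundaries_submodule_cycle_space: "submodule R (boundaries R K n) (cycle_space R K n)"
proof -
  interpret V: vectorspace R "func_space UNIV" by (rule func_space_vectorspace)
  show ?thesis
    unfolding cycle_space_def
    by (intro V.submodule_restrict cycles_submodule boundaries_submodule boundaries_subset_cycles
        face_closed)
qed

lemma homology_vectorspace: "vectorspace R (homology R K n)"
  unfolding homology_def by (rule Z.quotient_space_is_vs[OF boundaries_submodule_cycle_space])

lemma fin_dim_homology: "finite (\<Union>K) \<Longrightarrow> vectorspace.fin_dim R (homology R K n)"
  unfolding homology_def
  by (intro Z.fin_dim_quotient_space boundaries_submodule_cycle_space fin_dim_cycle_space)

text \<open>The quotient projection, named so that maps out of homology can be computed on
  cycles.\<close>

definition homology_class :: "('x list \<Rightarrow> 'a) \<Rightarrow> ('x list \<Rightarrow> 'a) set" where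
  "homology_class c = boundaries R K n +>\<^bsub>cycle_space R K n\<^esub> c"

lemma carrier_homology: "carrier (homology R K n) = homology_class ` cycles R K n"
  using Z.quotient_space_simps(1)[OF boundaries_submodule_cycle_space]
  by (simp add: homology_def homology_class_def cycle_space_def)

lemma homology_class_linear: "linear_map R (cycle_space R K n) (homology R K n) homology_class"
  using Z.coset_linear_map[OF boundaries_submodule_cycle_space]
  by (simp add: homology_def homology_class_def[abs_def])

lemma homology_class_eq:
  assumes "c \<in> cycles R K n" "c' \<in> boundaries R K n +>\<^bsub>cycle_space R K n\<^esub> c"
  shows "homology_class c' = homology_class c"
proof -
  interpret B: abelian_subgroup "boundaries R K n" "cycle_space R K n"
    by (rule Z.abelian_subgroup_submodule[OF boundaries_submodule_cycle_space])
  show ?thesis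
    unfolding homology_class_def
    by (rule B.a_repr_independence'[symmetric]) (use assms in \<open>simp_all add: cycle_space_def\<close>)
qed

lemma homology_class_self:
  assumes "c \<in> cycles R K n"
  shows "c \<in> homology_class c"
proof -
  interpret B: abelian_subgroup "boundaries R K n" "cycle_space R K n"
    by (rule Z.abelian_subgroup_submodule[OF boundaries_submodule_cycle_space])
  show ?thesis
    unfolding homology_class_def
    by (rule B.a_rcos_self) (use assms in \<open>simp add: cycle_space_def\<close>)
qed

end

locale subcomplex = K: simplicial_complex R K n + L: simplicial_complex R L n
  for R (structure) and K L :: "'x set set" and n +
  assumes subset: "K \<subseteq> L"
begin

text \<open>This justifies \<open>the_elem\<close>: boundaries of \<open>K\<close> are boundaries of
  \<open>L\<close>, so all representatives of a class of \<open>K\<close> have the same class in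
  \<open>L\<close>, and the image is a singleton because a class is nonempty.\<close>

lemma homology_inclusion_class:
  assumes c: "c \<in> cycles R K n"
  shows "homology_inclusion R L n (K.homology_class c) = L.homology_class c"
proof -
  have cL: "c \<in> cycles R L n"
    using c K.cycles_mono[OF subset] by blast
  have "L.homology_class c' = L.homology_class c" if "c' \<in> K.homology_class c" for c'
  proof (rule L.homology_class_eq[OF cL])
    show "c' \<in> boundaries R L n +>\<^bsub>cycle_space R L n\<^esub> c"
      using that K.boundaries_mono[OF subset, of n]
      by (auto simp: K.homology_class_def a_r_coset_def' cycle_space_def)
  qed
  then have "L.homology_class ` K.homology_class c = (\<lambda>_. L.homology_class c) ` K.homology_class c"
    by (rule image_cong[OF refl])
  also have "K.homology_class c \<noteq> {}"
    using K.homology_class_self[OF c] by blast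
  then have "(\<lambda>_. L.homology_class c) ` K.homology_class c = {L.homology_class c}"
    by (simp add: image_constant_conv)
  finally show ?thesis
    unfolding homology_inclusion_def L.homology_class_def[abs_def] by simp
qed

text \<open>Every class has a representing cycle, and the cycle spaces of \<open>K\<close> and
  \<open>L\<close> share their operations, so linearity follows from that of the two
  projections.\<close>

lemma homology_inclusion_linear:
  "linear_map R (homology R K n) (homology R L n) (homology_inclusion R L n)"
proof -
  interpret pK: linear_map R "cycle_space R K n" "homology R K n" K.homology_class
    by (rule K.homology_class_linear)
  interpret pL: linear_map R "cycle_space R L n" "homology R L n" L.homology_class
    by (rule L.homology_class_linear)
  have eqs: "carrier (cycle_space R K n) = cycles R K n"
      "add (cycle_space R L n) = add (cycle_space R K n)"
      "smult (cycle_space R L n) = smult (cycle_space R K n)"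
    by (simp_all add: cycle_space_def)
  have mono: "c \<in> carrier (cycle_space R L n)" if "c \<in> carrier (cycle_space R K n)" for c
    using that K.cycles_mono[OF subset] by (auto simp: cycle_space_def)
  have incl: "homology_inclusion R L n (K.homology_class c) = L.homology_class c"
    if "c \<in> carrier (cycle_space R K n)" for c
    using that by (simp add: homology_inclusion_class eqs(1))
  have carrier_K: "carrier (homology R K n) = K.homology_class ` carrier (cycle_space R K n)"
    by (simp add: K.carrier_homology eqs)
  have "homology_inclusion R L n \<in> module_hom R (homology R K n) (homology R L n)"
    unfolding module_hom_def carrier_K
  proof (intro CollectI conjI allI impI)
    show "homology_inclusion R L n \<in>
        K.homology_class ` carrier (cycle_space R K n) \<rightarrow> carrier (homology R L n)"
      by (auto simp: incl mono)
  next
    fix C C' assume *: "C \<in> K.homology_class ` carrier (cycle_space R K n) \<and>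
      C' \<in> K.homology_class ` carrier (cycle_space R K n)"
    obtain c where c: "c \<in> carrier (cycle_space R K n)" and C: "C = K.homology_class c"
      using *[THEN conjunct1] by (rule imageE)
    obtain c' where c': "c' \<in> carrier (cycle_space R K n)" and C': "C' = K.homology_class c'"
      using *[THEN conjunct2] by (rule imageE)
    have "homology_inclusion R L n (C \<oplus>\<^bsub>homology R K n\<^esub> C') =
        homology_inclusion R L n (K.homology_class (c \<oplus>\<^bsub>cycle_space R K n\<^esub> c'))"
      by (simp only: C C' pK.T_add[OF c c'])
    also have "\<dots> = L.homology_class (c \<oplus>\<^bsub>cycle_space R L n\<^esub> c')"
      unfolding eqs(2) using c c' by (intro incl K.Z.M.a_closed)
    also have "\<dots> = L.homology_class c \<oplus>\<^bsub>homology R L n\<^esub> L.homology_class c'"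
      by (rule pL.T_add[OF mono[OF c] mono[OF c']])
    finally show "homology_inclusion R L n (C \<oplus>\<^bsub>homology R K n\<^esub> C') =
        homology_inclusion R L n C \<oplus>\<^bsub>homology R L n\<^esub> homology_inclusion R L n C'"
      by (simp only: C C' incl[OF c] incl[OF c'])
  next
    fix a C assume *: "a \<in> carrier R \<and> C \<in> K.homology_class ` carrier (cycle_space R K n)"
    note a = *[THEN conjunct1]
    obtain c where c: "c \<in> carrier (cycle_space R K n)" and C: "C = K.homology_class c"
      using *[THEN conjunct2] by (rule imageE)
    have "homology_inclusion R L n (a \<odot>\<^bsub>homology R K n\<^esub> C) =
        homology_inclusion R L n (K.homology_class (a \<odot>\<^bsub>cycle_space R K n\<^esub> c))"
      by (simp only: C pK.T_smult[OF a c])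
    also have "\<dots> = L.homology_class (a \<odot>\<^bsub>cycle_space R L n\<^esub> c)"
      unfolding eqs(3) using a c by (intro incl K.Z.smult_closed)
    also have "\<dots> = a \<odot>\<^bsub>homology R L n\<^esub> L.homology_class c"
      by (rule pL.T_smult[OF a mono[OF c]])
    finally show "homology_inclusion R L n (a \<odot>\<^bsub>homology R K n\<^esub> C) =
        a \<odot>\<^bsub>homology R L n\<^esub> homology_inclusion R L n C"
      by (simp only: C incl[OF c])
  qed
  then show ?thesis
    by (intro linear_map.intro mod_hom.intro mod_hom_axioms.intro K.homology_vectorspace
        L.homology_vectorspace vectorspace.axioms(1))
qed

end

context field begin

lemma subcomplexI:
  assumes "face_closed K" "face_closed L" "K \<subseteq> L"
  shows "subcomplex R K L"
  using assms
  by (intro subcomplex.intro simplicial_complex.intro simplicial_complex_axioms.intro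
      subcomplex_axioms.intro field_axioms)

lemma homology_inclusion_refl:
  assumes "face_closed K" "C \<in> carrier (homology R K n)"
  shows "homology_inclusion R K n C = C"
proof -
  interpret subcomplex R K K n
    using assms(1) by (intro subcomplexI) simp_all
  obtain c where "c \<in> cycles R K n" "C = K.homology_class c"
    using assms(2) unfolding K.carrier_homology by (rule imageE)
  then show ?thesis
    by (simp add: homology_inclusion_class)
qed

text \<open>Both sides are the class in \<open>M\<close> of one and the same cycle. Within one
  filtration this is functoriality; alternating between two filtrations it gives the interleaving
  identities.\<close>

lemma homology_inclusion_comp:
  assumes "face_closed K" "face_closed L" "face_closed M" "K \<subseteq> L" "L \<subseteq> M"
    and "C \<in> carrier (homology R K n)"
  shows "homology_inclusion R M n (homology_inclusion R L n C) = homology_inclusion R M n C"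
proof -
  interpret KL: subcomplex R K L n
    using assms by (intro subcomplexI) simp_all
  interpret LM: subcomplex R L M n
    using assms by (intro subcomplexI) simp_all
  interpret KM: subcomplex R K M n
    using assms by (intro subcomplexI) auto
  obtain c where c: "c \<in> cycles R K n" and C: "C = KL.K.homology_class c"
    using assms(6) unfolding KL.K.carrier_homology by (rule imageE)
  have "c \<in> cycles R L n"
    using c cycles_mono[OF assms(4)] by blast
  with c show ?thesis
    by (simp only: C KL.homology_inclusion_class LM.homology_inclusion_class
        KM.homology_inclusion_class)
qed

end

section \<open>The Vietoris-Rips filtration\<close>

text \<open>\<open>diam\<close> is a \<open>Max\<close>, meaningful for finite nonempty sets;
  simplices satisfy both conditions.\<close>

lemma diam_le_iff:
  assumes "finite \<sigma>" "\<sigma> \<noteq> {}"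
  shows "diam \<rho> \<sigma> \<le> r \<longleftrightarrow> (\<forall>x\<in>\<sigma>. \<forall>y\<in>\<sigma>. \<rho> x y \<le> r)"
  using assms by (simp add: diam_def)

lemma mem_vietoris_rips:
  "\<sigma> \<in> vietoris_rips \<rho> S r \<longleftrightarrow>
    \<sigma> \<subseteq> S \<and> \<sigma> \<noteq> {} \<and> finite \<sigma> \<and> (\<forall>x\<in>\<sigma>. \<forall>y\<in>\<sigma>. \<rho> x y \<le> r)"
  unfolding vietoris_rips_def mem_Collect_eq using diam_le_iff[of \<sigma> \<rho> r] by blast

lemma mem_filtration:
  "\<sigma> \<in> filtration X \<Phi> \<phi> a \<longleftrightarrow> \<sigma> \<subseteq> X \<and> \<sigma> \<noteq> {} \<and> finite \<sigma> \<and>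
    (\<forall>x\<in>\<sigma>. \<phi> x \<le> snd a) \<and> (\<forall>x\<in>\<sigma>. \<forall>y\<in>\<sigma>. data_pseudometric \<Phi> x y \<le> fst a)"
  by (cases a) (auto simp: filtration_def mem_vietoris_rips sublevel_def)

lemma face_closed_filtration: "face_closed (filtration X \<Phi> \<phi> a)"
  unfolding face_closed_def
  by (intro ballI allI impI, unfold mem_filtration) (blast intro: finite_subset)

text \<open>Two measurements are allowed so that one statement serves the transition maps, where
  they coincide, and the interleaving maps, where they differ.\<close>

lemma filtration_subset:
  assumes "fst a \<le> fst b" "\<And>x. x \<in> X \<Longrightarrow> \<phi> x \<le> snd a \<Longrightarrow> \<psi> x \<le> snd b"
  shows "filtration X \<Phi> \<phi> a \<subseteq> filtration X \<Phi> \<psi> b"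
  using assms unfolding subset_iff mem_filtration by (meson order_trans)

text \<open>The complex depends on its indices only through the outcomes of comparisons with values
  of the pseudometric and of \<open>\<phi>\<close>. This is the source of constancy on
  blocks.\<close>

lemma filtration_cong:
  assumes "\<And>x y. x \<in> X \<Longrightarrow> y \<in> X \<Longrightarrow>
      data_pseudometric \<Phi> x y \<le> fst a \<longleftrightarrow> data_pseudometric \<Phi> x y \<le> fst b"
    and "\<And>x. x \<in> X \<Longrightarrow> \<phi> x \<le> snd a \<longleftrightarrow> \<phi> x \<le> snd b"
  shows "filtration X \<Phi> \<phi> a = filtration X \<Phi> \<phi> b"
  unfolding set_eq_iff mem_filtration using assms by (meson subsetD)

lemma finite_Union_filtration: "finite X \<Longrightarrow> finite (\<Union> (filtration X \<Phi> \<phi> a))"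
  by (rule finite_subset[of _ X]) (auto simp: mem_filtration)

lemma sup_dist_nonneg: "finite X \<Longrightarrow> 0 \<le> sup_dist X \<phi> \<psi>"
  by (simp add: sup_dist_def)

lemma abs_diff_le_sup_dist: "finite X \<Longrightarrow> x \<in> X \<Longrightarrow> \<bar>\<phi> x - \<psi> x\<bar> \<le> sup_dist X \<phi> \<psi>"
  by (simp add: sup_dist_def)

text \<open>The disjunction builds in the symmetry of the distance, so both directions of an
  interleaving can use the same \<open>\<epsilon>\<close>.\<close>

lemma filtration_subset_shift:
  assumes "finite X" and "sup_dist X \<phi> \<psi> \<le> \<epsilon> \<or> sup_dist X \<psi> \<phi> \<le> \<epsilon>"
  shows "filtration X \<Phi> \<phi> a \<subseteq> filtration X \<Phi> \<psi> (shift \<epsilon> a)"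
proof (rule filtration_subset)
  show "\<psi> x \<le> snd (shift \<epsilon> a)" if "x \<in> X" "\<phi> x \<le> snd a" for x
    using abs_diff_le_sup_dist[OF assms(1) that(1), of \<phi> \<psi>]
      abs_diff_le_sup_dist[OF assms(1) that(1), of \<psi> \<phi>] assms(2) that(2)
    by (auto simp: shift_def)
qed (simp add: shift_def)

lemma PH_simps:
  "obj (PH F X \<Phi> d \<phi>) a = homology F (filtration X \<Phi> \<phi> a) d"
  "trans_map (PH F X \<Phi> d \<phi>) a b = homology_inclusion F (filtration X \<Phi> \<phi> b) d"
  by (simp_all add: PH_def)

section \<open>Functoriality and the interleaving\<close>

context field begin

lemma homology_filtration_vectorspace: "vectorspace R (homology R (filtration X \<Phi> \<phi> a) n)"
  by (intro simplicial_complex.homology_vectorspace simplicial_complex.intro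
      simplicial_complex_axioms.intro field_axioms face_closed_filtration)

lemma pers_functor_PH: "pers_functor R (PH R X \<Phi> d \<phi>)"
proof -
  have mono: "filtration X \<Phi> \<phi> a \<subseteq> filtration X \<Phi> \<phi> b" if "a \<le> b" for a b
    using that by (intro filtration_subset) (auto simp: less_eq_prod_def)
  show ?thesis
    unfolding pers_functor_def PH_simps
    by (intro conjI ballI impI homology_filtration_vectorspace
        subcomplex.homology_inclusion_linear subcomplexI homology_inclusion_refl
        face_closed_filtration mono)
      (assumption | rule homology_inclusion_comp[OF face_closed_filtration face_closed_filtration
        face_closed_filtration mono mono])+
qed

lemma interleaved_PH:
  assumes "finite X"
  shows "interleaved R (sup_dist X \<phi> \<psi>) (PH R X \<Phi> d \<phi>) (PH R X \<Phi> d \<psi>)"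
proof -
  let ?\<epsilon> = "sup_dist X \<phi> \<psi>"
  \<comment> \<open>An induced map is determined by its target complex: \<open>?f \<psi>\<close>
    goes from the module of \<open>\<phi>\<close> to that of \<open>\<psi>\<close>, and
    \<open>?f \<phi>\<close> goes back.\<close>
  let ?f = "\<lambda>\<chi> a. homology_inclusion R (filtration X \<Phi> \<chi> (shift ?\<epsilon> a)) d"
  have sub: "filtration X \<Phi> \<phi> a \<subseteq> filtration X \<Phi> \<psi> (shift ?\<epsilon> a)"
    "filtration X \<Phi> \<psi> a \<subseteq> filtration X \<Phi> \<phi> (shift ?\<epsilon> a)" for a
    by (simp_all add: filtration_subset_shift[OF assms])
  \<comment> \<open>Writing the double shift as an iterated one exhibits the composite as a chain of
    two inclusions.\<close>
  have shift2: "shift (2 * ?\<epsilon>) a = shift ?\<epsilon> (shift ?\<epsilon> a)" for a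
    by (simp add: shift_def)
  show ?thesis
    unfolding interleaved_def PH_simps shift2
    by (rule exI[of _ "?f \<psi>"], rule exI[of _ "?f \<phi>"])
      (intro conjI ballI subcomplex.homology_inclusion_linear subcomplexI
        face_closed_filtration sub,
        (rule homology_inclusion_comp[OF face_closed_filtration face_closed_filtration
          face_closed_filtration sub(1) sub(2)]
          homology_inclusion_comp[OF face_closed_filtration face_closed_filtration
          face_closed_filtration sub(2) sub(1)], assumption)+)
qed

end

section \<open>Tameness\<close>

text \<open>Enumerates \<open>A\<close> increasingly, each new maximum being appended at the end.
  The last conjunct leaves no element strictly between neighbours, which makes blocks constant;
  membership of each \<open>s j\<close> in \<open>A\<close> carries the induction, since it places
  old breakpoints below the new maximum.\<close>

lemma breakpoints_exist:
  fixes A :: "'a::linorder set"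
  assumes "finite A" "A \<noteq> {}"
  shows "\<exists>(m::nat) s. s 0 = Min A \<and> s m = Max A \<and> (\<forall>j\<le>m. s j \<in> A) \<and>
    (\<forall>j<m. s j < s (Suc j)) \<and> (\<forall>j<m. \<forall>x\<in>A. x \<le> s j \<or> s (Suc j) \<le> x)"
  using assms
proof (induction A rule: finite_linorder_max_induct)
  case empty
  then show ?case by simp
next
  case (insert b A)
  show ?case
  proof (cases "A = {}")
    case True
    then show ?thesis
        by (intro exI[of _ 0] exI[of _ "\<lambda>_. b"]) simp
  next
    case False
    then obtain m s where s: "s 0 = Min A" "s m = Max A" "\<And>j. j < m \<Longrightarrow> s j < s (Suc j)"
        "\<And>j x. j < m \<Longrightarrow> x \<in> A \<Longrightarrow> x \<le> s j \<or> s (Suc j) \<le> x"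
        "\<And>j. j \<le> m \<Longrightarrow> s j \<in> A"
      using insert.IH by metis
    have b: "Max A < b" "Min A < b"
      using insert.hyps False by simp_all
    let ?s = "s(Suc m := b)"
    show ?thesis
    proof (intro exI[of _ "Suc m"] exI[of _ ?s] conjI allI impI ballI)
      show "?s 0 = Min (insert b A)" "?s (Suc m) = Max (insert b A)"
        using insert.hyps(1) False b s(1)
        by (simp_all only: Min_insert Max_insert fun_upd_apply) (simp_all add: min.absorb2 max.absorb1)
      show "?s j \<in> insert b A" if "j \<le> Suc m" for j
        using that s(5) by (cases "j = Suc m") simp_all
      show "?s j < ?s (Suc j)" if "j < Suc m" for j
        using that s(2,3) b by (cases "j = m") auto
      show "x \<le> ?s j \<or> ?s (Suc j) \<le> x" if "j < Suc m" "x \<in> insert b A" for j x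
      proof (cases "j = m")
        case True
        then show ?thesis
          using that s(2) insert.hyps(1) by auto
      next
        case False
        then have "j < m" using that(1) by simp
        then show ?thesis
          using that(2) s(4)[of j x] s(5)[of "Suc j"] insert.hyps(2) by auto
      qed
    qed
  qed
qed

lemma data_pseudometric_nonneg: "finite \<Phi> \<Longrightarrow> 0 \<le> data_pseudometric \<Phi> x y"
  by (simp add: data_pseudometric_def)

context field begin

text \<open>Equal complexes have the same homology, and the transition map between them is the
  identity.\<close>

lemma constant_on_PH:
  assumes "\<And>a b. a \<in> B \<Longrightarrow> b \<in> B \<Longrightarrow> filtration X \<Phi> \<phi> a = filtration X \<Phi> \<phi> b"
  shows "constant_on (PH R X \<Phi> d \<phi>) B"
  unfolding constant_on_def PH_simps
proof (intro ballI impI)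
  fix a b assume "a \<in> B" "b \<in> B"
  then have eq: "filtration X \<Phi> \<phi> a = filtration X \<Phi> \<phi> b"
    by (rule assms)
  show "bij_betw (homology_inclusion R (filtration X \<Phi> \<phi> b) d)
      (carrier (homology R (filtration X \<Phi> \<phi> a) d)) (carrier (homology R (filtration X \<Phi> \<phi> b) d))"
    unfolding eq
    by (subst bij_betw_cong[where g = "\<lambda>C. C"])
      (simp_all add: homology_inclusion_refl[OF face_closed_filtration] bij_betw_def)
qed

lemma PH_in_Tame:
  assumes "data_set X \<Phi>"
  shows "PH R X \<Phi> d \<phi> \<in> Tame R"
proof -
  have X: "finite X" and \<Phi>: "finite \<Phi>"
    using assms by (simp_all add: data_set_def)
  let ?P = "PH R X \<Phi> d \<phi>"
  \<comment> \<open>Inserting \<open>0\<close> and \<open>\<infinity>\<close> forces the end points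
    that \<open>Tame\<close> prescribes; \<open>0\<close> is the minimum since distances are
    nonnegative.\<close>
  let ?A = "insert 0 (insert \<infinity> ((\<lambda>(x, y). ereal (data_pseudometric \<Phi> x y)) ` (X \<times> X)))"
  have "finite ?A" "?A \<noteq> {}"
    using X by simp_all
  then obtain m r where r: "r 0 = Min ?A" "r m = Max ?A" "\<forall>i<m. r i < r (Suc i)"
      "\<And>i t. i < m \<Longrightarrow> t \<in> ?A \<Longrightarrow> t \<le> r i \<or> r (Suc i) \<le> t"
    using breakpoints_exist[of ?A] by metis
  \<comment> \<open>For empty \<open>X\<close> the only breakpoint is \<open>\<infinity>\<close>, so
    \<open>l = 0\<close> and the blocks below \<open>s 0\<close> cover every level.\<close>
  let ?B = "insert \<infinity> ((\<lambda>x. ereal (\<phi> x)) ` X)"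
  have finB: "finite ?B" "?B \<noteq> {}"
    using X by simp_all
  then obtain l s where s: "s 0 = Min ?B" "s l = Max ?B" "\<forall>j<l. s j < s (Suc j)"
      "\<And>j t. j < l \<Longrightarrow> t \<in> ?B \<Longrightarrow> t \<le> s j \<or> s (Suc j) \<le> t"
    using breakpoints_exist[of ?B] by metis
  have "Min ?A = 0"
    using X by (intro Min_eqI) (auto simp: data_pseudometric_nonneg[OF \<Phi>])
  moreover have "Max ?A = \<infinity>" "Max ?B = \<infinity>"
    using X by (intro Max_eqI; auto)+
  moreover have "- \<infinity> < Min ?B"
    using X by (subst Min_gr_iff) auto
  ultimately have ends: "r 0 = 0" "r m = \<infinity>" "- \<infinity> < s 0" "s l = \<infinity>"
    using r s by simp_all
  \<comment> \<open>A threshold \<open>t\<close> that is not strictly inside the half-open block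
    from \<open>p\<close> to \<open>q\<close> compares alike with all points of the block;
    \<open>t = p\<close> counts as reached because the block contains \<open>p\<close>.\<close>
  have between: "t \<le> x \<longleftrightarrow> t \<le> y"
    if "t \<le> p \<or> q \<le> t" "p \<le> x" "x < q" "p \<le> y" "y < q" for t p q x y :: ereal
    using that by auto
  have radius: "data_pseudometric \<Phi> u v \<le> x \<longleftrightarrow> data_pseudometric \<Phi> u v \<le> x'"
    if "i < m" "u \<in> X" "v \<in> X" "r i \<le> ereal x" "ereal x < r (Suc i)"
      "r i \<le> ereal x'" "ereal x' < r (Suc i)" for i u v x x'
  proof -
    have "ereal (data_pseudometric \<Phi> u v) \<in> ?A"
      using that(2,3) by auto
    from between[OF r(4)[OF that(1) this] that(4-7)] show ?thesis by simp
  qed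
  have level: "\<phi> u \<le> y \<longleftrightarrow> \<phi> u \<le> y'"
    if "j < l" "u \<in> X" "s j \<le> ereal y" "ereal y < s (Suc j)"
      "s j \<le> ereal y'" "ereal y' < s (Suc j)" for j u y y'
  proof -
    have "ereal (\<phi> u) \<in> ?B"
      using that(2) by simp
    from between[OF s(4)[OF that(1) this] that(3-6)] show ?thesis by simp
  qed
  \<comment> \<open>Below the least value of \<open>\<phi>\<close> all sublevel sets are empty, so
    every comparison there fails.\<close>
  have below: "\<not> \<phi> u \<le> y" if "u \<in> X" "ereal y < s 0" for u y
  proof -
    have "s 0 \<le> ereal (\<phi> u)"
      unfolding s(1) using finB(1) that(1) by (intro Min_le) simp_all
    with that(2) have "ereal y < ereal (\<phi> u)"
      by (rule less_le_trans)
    then show ?thesis by simp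
  qed
  have const_below: "constant_on ?P {(x, y). r i \<le> ereal x \<and> ereal x < r (Suc i) \<and> ereal y < s 0}"
    (is "constant_on ?P ?B") if i: "i < m" for i
  proof (rule constant_on_PH, rule filtration_cong)
    fix a b assume ab: "a \<in> ?B" "b \<in> ?B"
    show "data_pseudometric \<Phi> u v \<le> fst a \<longleftrightarrow> data_pseudometric \<Phi> u v \<le> fst b"
      if "u \<in> X" "v \<in> X" for u v
      by (rule radius[OF i that]) (use ab in auto)
    show "\<phi> u \<le> snd a \<longleftrightarrow> \<phi> u \<le> snd b" if "u \<in> X" for u
      using below[OF that, of "snd a"] below[OF that, of "snd b"] ab by auto
  qed
  have const: "constant_on ?P {(x, y). r i \<le> ereal x \<and> ereal x < r (Suc i) \<and>
      s j \<le> ereal y \<and> ereal y < s (Suc j)}"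
    (is "constant_on ?P ?B") if ij: "i < m" "j < l" for i j
  proof (rule constant_on_PH, rule filtration_cong)
    fix a b assume ab: "a \<in> ?B" "b \<in> ?B"
    show "data_pseudometric \<Phi> u v \<le> fst a \<longleftrightarrow> data_pseudometric \<Phi> u v \<le> fst b"
      if "u \<in> X" "v \<in> X" for u v
      by (rule radius[OF ij(1) that]) (use ab in auto)
    show "\<phi> u \<le> snd a \<longleftrightarrow> \<phi> u \<le> snd b" if "u \<in> X" for u
      by (rule level[OF ij(2) that]) (use ab in auto)
  qed
  have fin_dim: "vectorspace.fin_dim R (obj ?P a)" for a
    unfolding PH_simps
    by (intro simplicial_complex.fin_dim_homology simplicial_complex.intro
        simplicial_complex_axioms.intro field_axioms face_closed_filtration finite_Union_filtration X)
  show ?thesis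
    unfolding Tame_def
    by (intro CollectI conjI ballI pers_functor_PH fin_dim,
        rule exI[of _ m], rule exI[of _ l], rule exI[of _ r], rule exI[of _ s])
      (intro conjI allI impI ends const_below const r(3)[rule_format] s(3)[rule_format])
qed

end

theorem proposition1:
  fixes F :: "('k, 'm) ring_scheme"
    and X :: "'x set"
    and \<Phi> :: "('x \<Rightarrow> real) set"
    and d :: nat
  assumes "field F"
    and "data_set X \<Phi>"
  shows "PH F X \<Phi> d \<in> \<Phi> \<rightarrow> Tame F \<and>
    (\<forall>\<phi> \<in> \<Phi>. \<forall>\<psi> \<in> \<Phi>.
       interleaving_dist F (PH F X \<Phi> d \<phi>) (PH F X \<Phi> d \<psi>) \<le> ereal (sup_dist X \<phi> \<psi>))"
proof (intro conjI ballI Pi_I)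
  interpret field F by (rule assms)
  have X: "finite X"
    using assms(2) by (simp add: data_set_def)
  show "PH F X \<Phi> d \<phi> \<in> Tame F" for \<phi>
    by (rule PH_in_Tame[OF assms(2)])
  show "interleaving_dist F (PH F X \<Phi> d \<phi>) (PH F X \<Phi> d \<psi>) \<le> ereal (sup_dist X \<phi> \<psi>)" for \<phi> \<psi>
    unfolding interleaving_dist_def
    \<comment> \<open>The distance is itself an admissible interleaving parameter, nonnegativity
      included, so the infimum does not exceed it.\<close>
    using sup_dist_nonneg[OF X] interleaved_PH[OF X] by (intro Inf_lower) blast
qed

end
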